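(* Let $\Gamma=\langle\omega\rangle\ltimes\Gamma(2)^\pm$ be the discrete subgroup of $\operatorname{SL}_2^\pm(\mathbb{R})$ generated by $\omega=\begin{pmatrix}0&-1\\1&0\end{pmatrix}$ and $\Gamma(2)^\pm$. Let $\epsilon\in\{\pm1\}$ and let $\gamma=\begin{pmatrix}a&b\\c&d\end{pmatrix}\in\Gamma$ if $\epsilon=1$, or $\gamma\in\Gamma\setminus\left\{\begin{pmatrix}-1&0\\0&-1\end{pmatrix},\begin{pmatrix}-1&0\\0&1\end{pmatrix}\right\}$ if $\epsilon=-1$. Then, for some constant $\lambda^\pm(\gamma,\epsilon)$, $$\theta_{1/2}\Big(\tfrac{az+b}{cz+d},\epsilon\Big)=\lambda^\pm(\gamma,\epsilon)\,\sqrt{\det\gamma\,(cz+d)}\,\sum_{n\in\mathbb{Z}}e^{i(\det\gamma)\epsilon\pi n^2z},$$ $$\theta_{3/2}\Big(\tfrac{az+b}{cz+d},\epsilon\Big)=\lambda^\pm(\gamma,\epsilon)\,\Big(\sqrt{\det\gamma\,(cz+d)}\Big)^3\,\sum_{n\in\mathbb{Z}}n\,e^{i(\det\gamma)\epsilon\pi n^2z}$$ for $z\in\mathcal{H}^\pm$.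
   Context: $\mathcal{H}^\pm=\{z\in\mathbb{C}:\mathrm{Im}\,z\neq0\}$. $\operatorname{SL}_2^\pm(\mathbb{R})=\{g\in\operatorname{GL}_2(\mathbb{R}):\det g=\pm1\}$, $\operatorname{SL}_2^\pm(\mathbb{Z})$ is its subgroup of integral matrices, and $\Gamma(2)^\pm=\{g\in\operatorname{SL}_2^\pm(\mathbb{Z}):g\equiv I\bmod 2\}$. For $z\in\mathcal{H}^\pm$ and $\epsilon\in\{\pm1\}$, $\theta_{1/2}(z,\epsilon)=\sum_{n\in\mathbb{Z}}e^{i\epsilon\pi n^2z}$ and $\theta_{3/2}(z,\epsilon)=\sum_{n\in\mathbb{Z}}n\,e^{i\epsilon\pi n^2z}$. The square root is chosen so that $\sqrt{re^{i\theta}}=r^{1/2}e^{i\theta/2}$ for $r>0$, $-\pi<\theta<\pi$, and $\sqrt{-1}=-i$ in the case where $c=0$ and the argument of the root is $-1$. *)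

theory Defs
  imports "HOL-Analysis.Analysis" "HOL-Algebra.Generated_Groups"
begin

definition Hpm :: "complex set" where
  "Hpm = {z. Im z \<noteq> 0}"

definition mat2 :: "real \<Rightarrow> real \<Rightarrow> real \<Rightarrow> real \<Rightarrow> real ^ 2 ^ 2" where
  "mat2 a b c d = vector [vector [a, b], vector [c, d]]"

definition SL2pm_R :: "(real ^ 2 ^ 2) monoid" where
  "SL2pm_R = \<lparr>carrier = {g. det g = 1 \<or> det g = -1}, mult = (**), one = mat 1\<rparr>"

lemma group_SL2pm_R: "group SL2pm_R"
proof (rule groupI)
  fix x assume x: "x \<in> carrier SL2pm_R"
  then have "invertible x"
    by (auto simp: SL2pm_R_def invertible_det_nz)
  then obtain y where y: "x ** y = mat 1" "y ** x = mat 1"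
    by (auto simp: invertible_def)
  have "det y * det x = 1"
    by (metis det_mul y(2) det_I)
  with x y show "\<exists>y\<in>carrier SL2pm_R. y \<otimes>\<^bsub>SL2pm_R\<^esub> x = \<one>\<^bsub>SL2pm_R\<^esub>"
    by (auto simp: SL2pm_R_def)
qed (auto simp: SL2pm_R_def det_mul matrix_mul_assoc)

definition SL2pm_Z :: "(real ^ 2 ^ 2) set" where
  "SL2pm_Z = {g \<in> carrier SL2pm_R. \<forall>i j. g $ i $ j \<in> \<int>}"

definition Gamma2pm :: "(real ^ 2 ^ 2) set" where
  "Gamma2pm = {g \<in> SL2pm_Z. \<forall>i j. \<exists>k::int. (g - mat 1) $ i $ j = 2 * of_int k}"

definition omega :: "real ^ 2 ^ 2" where
  "omega = mat2 0 (-1) 1 0"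

text \<open>The product of \<open>\<langle>omega\<rangle>\<close> and \<open>Gamma2pm\<close> is not a semidirect product in the strict
  sense, because \<open>omega\<close> squared is minus the identity and lies in \<open>Gamma2pm\<close>.\<close>

definition Gamma_grp :: "(real ^ 2 ^ 2) set" where
  "Gamma_grp = generate SL2pm_R (insert omega Gamma2pm)"

text \<open>For \<open>z \<in> Hpm\<close> and \<open>\<epsilon> = 1\<close> or \<open>-1\<close>, both series converge if and only if \<open>\<epsilon> * Im z > 0\<close>;
  otherwise \<open>infsum\<close> has the value 0 by convention. The series in \<open>theta_three_half\<close> is odd
  in \<open>n\<close>, so its sum always vanishes.\<close>

definition theta_half :: "complex \<Rightarrow> real \<Rightarrow> complex" where
  "theta_half z \<epsilon> = (\<Sum>\<^sub>\<infinity>n::int. exp (\<i> * of_real \<epsilon> * of_real pi * of_int n ^ 2 * z))"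

definition theta_three_half :: "complex \<Rightarrow> real \<Rightarrow> complex" where
  "theta_three_half z \<epsilon> =
     (\<Sum>\<^sub>\<infinity>n::int. of_int n * exp (\<i> * of_real \<epsilon> * of_real pi * of_int n ^ 2 * z))"

text \<open>\<open>csqrt\<close> is the principal branch, but with \<open>csqrt (-1) = \<i>\<close>. In \<open>sqrt_pm (det \<gamma> * (c z + d))\<close>
  with \<open>z \<in> Hpm\<close> the argument is real only if \<open>c = 0\<close>, and for \<open>\<gamma> \<in> Gamma_grp\<close> it is then 1 or -1.\<close>

definition sqrt_pm :: "complex \<Rightarrow> complex" where
  "sqrt_pm w = (if w = -1 then -\<i> else csqrt w)"

lemma sqrt_pm_polar:
  assumes "r > 0" "-pi < t" "t < pi"
  shows "sqrt_pm (of_real r * exp (\<i> * of_real t)) = of_real (sqrt r) * exp (\<i> * of_real (t / 2))"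
proof -
  let ?w = "complex_of_real r * exp (\<i> * of_real t)"
  have Ln: "Ln ?w = of_real (ln r) + \<i> * of_real t"
    using assms by (intro Ln_unique) (auto simp: exp_add exp_of_real)
  have nz: "?w \<noteq> 0"
    using assms by simp
  have "?w \<noteq> -1"
  proof
    assume "?w = -1"
    with Ln have "Ln (-1) = of_real (ln r) + \<i> * complex_of_real t" by simp
    then have "\<i> * of_real pi = of_real (ln r) + \<i> * complex_of_real t" by simp
    then have "pi = t" by (simp add: complex_eq_iff)
    with assms show False by simp
  qed
  then have "sqrt_pm ?w = csqrt ?w"
    by (simp add: sqrt_pm_def)
  also have "\<dots> = exp (Ln ?w / 2)"
    using nz by (rule csqrt_exp_Ln)
  also have "\<dots> = exp (of_real (ln r / 2)) * exp (\<i> * of_real (t / 2))"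
    by (simp add: Ln add_divide_distrib exp_add)
  also have "exp (complex_of_real (ln r / 2)) = of_real (sqrt r)"
    using assms by (simp only: exp_of_real) (simp add: ln_sqrt [symmetric])
  finally show ?thesis .
qed

end

theory Submission
  imports Defs "HOL-Complex_Analysis.Complex_Analysis" "HOL-Real_Asymp.Real_Asymp"
begin

text \<open>The identity for \<open>theta_three_half\<close> is \<open>0 = 0\<close>: both of its series are odd in the summation index
  (\<open>odd_theta_series_zero\<close>). All the content lies in \<open>\<theta> z = theta_half z 1\<close>, which is
  \<open>\<Sum>n. exp (\<i> pi n^2 z)\<close> on the upper half-plane and \<open>0\<close> (divergence) on the lower one.

  Write \<open>D = det \<gamma>\<close>. The two sides of the identity involve \<open>\<theta>\<close> at \<open>\<epsilon> * \<gamma> z\<close> and at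
  \<open>t = D * \<epsilon> * z\<close>, whose imaginary parts have the same sign. If the sign is negative, both sides vanish. If it
  is positive, \<open>\<epsilon> * \<gamma> z\<close> is the image of \<open>t\<close> under the matrix with rows \<open>(a D, \<epsilon> b)\<close> and
  \<open>(c D \<epsilon>, d)\<close>. It has determinant 1 and reduces modulo 2 to \<open>I\<close> or \<open>omega\<close>, since every element of
  \<open>Gamma_grp\<close> does (\<open>Gamma_grp_subset\<close>). This reduces the claim to the transformation law
  \<open>theta_half_moebius\<close> of \<open>\<theta>\<close> under the theta group.

  That law follows by Euclidean descent on \<open>\<bar>c\<bar>\<close> from the period 2 of \<open>\<theta>\<close> and from Jacobi's
  inversion \<open>\<theta> (-1/z) = csqrt (-\<i> z) * \<theta> z\<close> (\<open>theta_half_inversion\<close>). The square roots that accumulate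
  need no bookkeeping: two continuous branches on a connected set with proportional squares are proportional
  (\<open>square_proportional_imp_proportional\<close>), and only the existence of the constant is at stake.

  Jacobi's inversion is proved on the imaginary axis by Polya's method and then extended by the identity theorem.
  Averaging \<open>cos (pi j / l) ^ (2 m)\<close> over the residues \<open>j\<close> modulo \<open>l\<close> extracts every \<open>l\<close>-th
  binomial coefficient of \<open>(1 + x) ^ (2 m)\<close>, counted from the middle (\<open>discrete_poisson\<close>). If \<open>m / l^2\<close> tends
  to \<open>u\<close>, both the powers of cosines and the binomial coefficients become Gaussian, and the exact finite identity
  turns into the inversion formula with parameter \<open>pi * u\<close> (\<open>gaussian_poisson\<close>).\<close>

section \<open>Estimates for cosines and binomial coefficients\<close>


lemma binomial_ratio_Suc:
  assumes "n < m"
  shows "real ((2*m) choose (m + Suc n)) = real ((2*m) choose (m+n)) * (real (m - n) / real (m + Suc n))"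
proof -
  have "Suc (m+n) * ((2*m) choose Suc (m+n)) = (2*m - (m+n)) * ((2*m) choose (m+n))"
    using binomial_absorb_comp[of "2*m" "m+n"] times_binomial_minus1_eq[of "Suc (m+n)" "2*m"]
    by (simp del: mult_Suc)
  hence "real (Suc (m+n)) * real ((2*m) choose Suc (m+n)) = real (m-n) * real ((2*m) choose (m+n))"
    by (metis of_nat_mult diff_add_inverse2 mult_2 diff_diff_left diff_add_inverse)
  thus ?thesis by (simp add: field_simps)
qed

text \<open>The ratio is the product of the factors \<open>(m + 1 - i) / (m + i) = 1 - (2 i - 1) / (m + i)\<close> for
  \<open>i = 1, \<dots>, n\<close>. Each factor is bounded on both sides by \<open>1 + x \<le> exp x\<close>, and the numbers \<open>2 i - 1\<close> sum
  to \<open>n^2\<close>. The parameter \<open>k\<close> replaces \<open>n\<close> in the denominators so that they stay fixed during the induction;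
  \<open>k = n\<close> is sharp enough for limits, \<open>k = m\<close> gives a uniform majorant.\<close>

lemma central_ratio_bounds:
  assumes "n \<le> m" "n \<le> k" "k \<le> m"
  shows "exp (- ((real n)^2 / (real m + 1 - real k))) \<le> real ((2*m) choose (m+n)) / real ((2*m) choose m)
    \<and> real ((2*m) choose (m+n)) / real ((2*m) choose m) \<le> exp (- ((real n)^2 / (real m + real k)))"
  using assms
proof (induction n)
  case 0
  then show ?case by simp
next
  case (Suc n)
  define C where "C = real ((2*m) choose m)"
  define q where "q = real (m - n) / real (m + Suc n)"
  have Cpos: "C > 0" by (simp add: C_def)
  have q: "real ((2*m) choose (m + Suc n)) / C = real ((2*m) choose (m+n)) / C * q"
    using binomial_ratio_Suc[of n m] Suc.prems by (simp add: q_def)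
  have mn: "real (m - n) = real m - real n" "real m - real n \<ge> 1" using Suc.prems by linarith+
  have "q = 1 + (-((2*real n+1) / (real m + real n + 1)))"
    using mn by (simp add: q_def field_simps)
  hence "q \<le> exp (-((2*real n+1) / (real m + real n + 1)))"
    using exp_ge_add_one_self by metis
  also have "\<dots> \<le> exp (-((2*real n+1) / (real m + real k)))"
    using Suc.prems by (simp add: frac_le)
  finally have up: "q \<le> exp (-((2*real n+1) / (real m + real k)))" .
  have "inverse q = 1 + (2*real n+1) / (real m - real n)"
    using mn by (simp add: q_def field_simps)
  also have "\<dots> \<le> exp ((2*real n+1) / (real m - real n))"
    by (rule exp_ge_add_one_self)
  also have "\<dots> \<le> exp ((2*real n+1) / (real m + 1 - real k))"
    using Suc.prems mn by (simp add: frac_le)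
  finally have "inverse q \<le> inverse (exp (-((2*real n+1) / (real m + 1 - real k))))"
    by (simp add: exp_minus)
  hence lo: "exp (-((2*real n+1) / (real m + 1 - real k))) \<le> q"
    by (rule inverse_le_imp_le) (use mn in \<open>simp add: q_def\<close>)
  have e: "exp (- ((real (Suc n))^2 / x)) = exp (- ((real n)^2 / x)) * exp (-((2*real n+1) / x))" for x
    by (simp add: exp_add[symmetric] add_divide_distrib[symmetric] power2_eq_square algebra_simps)
  have IH: "exp (- ((real n)^2 / (real m + 1 - real k))) \<le> real ((2*m) choose (m+n)) / C"
      "real ((2*m) choose (m+n)) / C \<le> exp (- ((real n)^2 / (real m + real k)))"
    using Suc unfolding C_def by auto
  show ?case unfolding C_def[symmetric] q e
    by (intro conjI mult_mono IH up lo) (simp_all add: C_def q_def)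
qed

text \<open>The constant 3 is not optimal; any positive multiple of \<open>x^2\<close> in the exponent would give a summable
  majorant.\<close>

lemma cos_le_exp:
  fixes x :: real
  assumes "0 \<le> x" "x \<le> 2"
  shows "cos x \<le> exp (- (x^2/3))"
proof (cases "x = 0")
  case False
  then obtain t where t: "cos x = (\<Sum>m<4. cos_coeff m * x ^ m) + (cos (t + 1/2 * real 4 * pi) / fact 4) * x ^ 4"
    using Maclaurin_cos_expansion2[of x 4] assms by auto
  have "cos x = 1 - x^2/2 + cos t * x^4/24"
    unfolding t by (simp add: cos_coeff_def lessThan_nat_numeral lessThan_Suc fact_numeral)
  also have "cos t * x^4 \<le> 1 * x^4" by (intro mult_right_mono) auto
  also have "1 * x^4 \<le> 2^2 * x^2"
    using power_mono[of x 2 2] assms by (simp add: mult_right_mono power4_eq_xxxx power2_eq_square mult_left_mono mult.assoc[symmetric])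
  finally have "cos x \<le> 1 + (- (x^2/3))" by (simp add: field_simps)
  also have "\<dots> \<le> exp (- (x^2/3))" by (rule exp_ge_add_one_self)
  finally show ?thesis .
qed simp

text \<open>The squared central term times \<open>2 m + 1\<close> is exactly the reciprocal of the \<open>m\<close>-th Wallis product.\<close>

lemma central_binomial_asymp:
  "(\<lambda>m. (real ((2*m) choose m) / 4^m)^2 * (2 * real m + 1)) \<longlonglongrightarrow> 2/pi"
proof -
  have "(real ((2*m) choose m) / 4^m)^2 * (2 * real m + 1) = inverse (\<Prod>k=1..m. (4*real k^2) / (4*real k^2 - 1))" for m
  proof (induction m)
    case (Suc m)
    define X Z where "X = real ((2*Suc m) choose Suc m)" and "Z = real ((2*m) choose m)"
    have "Suc m * ((2*Suc m) choose Suc m) = Suc m * (2 * ((2*m+1) choose m))"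
      using Suc_times_binomial_eq[of "2*m+1" m] by (simp add: algebra_simps)
    hence "(2*Suc m) choose Suc m = 2 * ((2*m+1) choose m)"
      by (simp only: mult_cancel1) simp
    moreover have "Suc m * ((2*m+1) choose m) = (2*m+1) * ((2*m) choose m)"
      using binomial_absorb_comp[of "2*m+1" m] by simp
    ultimately have "Suc m * ((2*Suc m) choose Suc m) = 2 * (2*m+1) * ((2*m) choose m)"
      by (simp only: mult.left_commute mult.assoc)
    hence "real (Suc m * ((2*Suc m) choose Suc m)) = real (2 * (2*m+1) * ((2*m) choose m))"
      by (simp only:)
    hence "real (Suc m) * X = 2 * (2*real m+1) * Z"
      unfolding X_def Z_def by (simp only: of_nat_mult) simp
    hence "X = 2 * (2*real m+1) * Z / real (Suc m)"
      by (simp add: field_simps del: of_nat_Suc)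
    moreover have "(2 * w * Z / c / (4*P))^2 * (w+2) = (Z/P)^2 * w * (w * (w+2) / (4*c^2))"
      if "c \<noteq> 0" "P \<noteq> 0" for w c P :: real
      using that by (simp add: field_simps power2_eq_square)
    from this[of "real (Suc m)" "4^m" "2*real m+1"]
    have "(2 * (2*real m+1) * Z / real (Suc m) / 4^Suc m)^2 * (2 * real (Suc m) + 1)
       = (Z / 4^m)^2 * (2 * real m + 1) * ((2*real m+1) * (2*real m+3) / (4*real (Suc m)^2))"
      by (simp add: add_ac)
    ultimately have "(X / 4^Suc m)^2 * (2 * real (Suc m) + 1)
       = (Z / 4^m)^2 * (2 * real m + 1) * ((2*real m+1) * (2*real m+3) / (4*real (Suc m)^2))"
      by (simp only:)
    also have "(2*real m+1) * (2*real m+3) / (4*real (Suc m)^2) = inverse ((4*real (Suc m)^2) / (4*real (Suc m)^2 - 1))"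
      by (simp add: field_simps power2_eq_square)
    finally have "(X / 4^Suc m)^2 * (2 * real (Suc m) + 1)
       = (Z / 4^m)^2 * (2 * real m + 1) * inverse ((4*real (Suc m)^2) / (4*real (Suc m)^2 - 1))" .
    moreover have "(\<Prod>k=1..Suc m. (4*real k^2) / (4*real k^2 - 1))
       = (4*real (Suc m)^2) / (4*real (Suc m)^2 - 1) * (\<Prod>k=1..m. (4*real k^2) / (4*real k^2 - 1))"
      by (rule prod.nat_ivl_Suc') simp
    ultimately show ?case
      unfolding Suc.IH[folded Z_def] X_def[symmetric] by (simp only: inverse_mult_distrib mult.commute)
  qed simp
  thus ?thesis using tendsto_inverse[OF wallis] unfolding inverse_divide by simp
qed

section \<open>A finite Poisson summation formula\<close>

lemma sum_split_middle:
  fixes g :: "nat \<Rightarrow> 'a::comm_monoid_add"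
  shows "(\<Sum>k\<le>2*m. g k) = g m + (\<Sum>n=1..m. g (m+n) + g (m-n))"
proof -
  have 1: "(\<Sum>n=1..m. g (m+n)) = sum g {m<..2*m}"
    by (rule sum.reindex_bij_witness[of _ "\<lambda>k. k-m" "\<lambda>n. m+n"]) auto
  have 2: "(\<Sum>n=1..m. g (m-n)) = sum g {..<m}"
    by (rule sum.reindex_bij_witness[of _ "\<lambda>k. m-k" "\<lambda>n. m-n"]) auto
  have "{..2*m} = {..<m} \<union> ({m} \<union> {m<..2*m})" by auto
  hence "sum g {..2*m} = sum g ({..<m} \<union> ({m} \<union> {m<..2*m}))" by (simp only:)
  also have "\<dots> = sum g {..<m} + (g m + sum g {m<..2*m})"
    by (subst sum.union_disjoint; (subst sum.union_disjoint)?) auto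
  finally show ?thesis unfolding sum.distrib 1 2 by (simp add: add_ac)
qed

lemma cos_power_even:
  fixes x :: real
  shows "4^m * cos x ^ (2*m) = real ((2*m) choose m) + 2 * (\<Sum>n=1..m. real ((2*m) choose (m+n)) * cos (2 * real n * x))"
proof -
  have "complex_of_real (4^m * cos x ^ (2*m)) = (cis x + cis (-x)) ^ (2*m)"
  proof -
    have "cis x + cis (-x) = of_real (2 * cos x)" by (simp add: complex_eq_iff)
    thus ?thesis by (simp add: power_mult power_mult_distrib)
  qed
  also have "\<dots> = (\<Sum>k\<le>2*m. of_nat ((2*m) choose k) * cis x ^ k * cis (-x) ^ (2*m-k))"
    by (rule binomial_ring)
  also have "\<dots> = (\<Sum>k\<le>2*m. of_nat ((2*m) choose k) * cis ((2*real k - 2*real m) * x))"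
    by (intro sum.cong refl) (simp add: Complex.DeMoivre cis_mult of_nat_diff algebra_simps)
  finally have "Re (complex_of_real (4^m * cos x ^ (2*m))) = Re \<dots>" by simp
  hence "4^m * cos x ^ (2*m) = (\<Sum>k\<le>2*m. real ((2*m) choose k) * cos ((2*real k - 2*real m) * x))"
    by simp
  also have "\<dots> = real ((2*m) choose m) + (\<Sum>n=1..m. 2 * (real ((2*m) choose (m+n)) * cos (2 * real n * x)))"
    unfolding sum_split_middle
  proof (intro arg_cong2[where f="(+)"] sum.cong refl)
    fix n assume n: "n \<in> {1..m}"
    hence "(2*m) choose (m-n) = (2*m) choose (m+n)"
      using binomial_symmetric[of "m-n" "2*m"] by (simp add: algebra_simps)
    moreover have "cos ((2*real (m-n) - 2*real m) * x) = cos (2 * real n * x)"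
      using n by (subst cos_minus[symmetric]) (simp add: of_nat_diff algebra_simps)
    ultimately show "real ((2*m) choose (m+n)) * cos ((2*real (m+n) - 2*real m) * x) +
        real ((2*m) choose (m-n)) * cos ((2*real (m-n) - 2*real m) * x)
       = 2 * (real ((2*m) choose (m+n)) * cos (2 * real n * x))" by simp
  qed simp
  finally show ?thesis by (simp add: sum_distrib_left)
qed

lemma sin_times_dirichlet:
  fixes x :: real
  shows "sin x * (1 + 2 * (\<Sum>j=1..r. cos (2 * real j * x))) = sin ((2 * real r + 1) * x)"
proof (induction r)
  case (Suc r)
  have "2 * (sin x * cos (2 * real (Suc r) * x)) = sin ((2 * real (Suc r) + 1) * x) - sin ((2 * real r + 1) * x)"
  proof -
    define y where "y = 2 * real (Suc r) * x"
    have "(2 * real (Suc r) + 1) * x = y + x" "(2 * real r + 1) * x = y - x" by (simp_all add: y_def algebra_simps)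
    thus ?thesis unfolding y_def[symmetric] by (simp add: sin_add sin_diff)
  qed
  with Suc show ?case by (simp add: algebra_simps)
qed simp

text \<open>For odd modulus \<open>l = 2 r + 1\<close> the residues \<open>-r, \<dots>, r\<close> are symmetric, so the orthogonality of
  characters modulo \<open>l\<close> is a statement about the real Dirichlet kernel at multiples of \<open>pi / l\<close>.\<close>

lemma dirichlet_kernel_value:
  fixes r n :: nat
  shows "1 + 2 * (\<Sum>j=1..r. cos (2 * real n * (pi * real j / (2*real r+1)))) = (if (2*r+1) dvd n then 2*real r+1 else 0)"
proof -
  define x where "x = pi * real n / (2*real r+1)"
  have eq: "2 * real n * (pi * real j / (2*real r+1)) = 2 * real j * x" for j
    by (simp add: x_def)
  show ?thesis
  proof (cases "(2*r+1) dvd n")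
    case True
    then obtain k where k: "n = (2*r+1)*k" by auto
    hence "x = pi * real k" by (simp add: x_def field_simps)
    hence "cos (2 * real j * x) = 1" for j
      using cos_int_2pin[of "int (j*k)"] by (simp add: mult_ac)
    thus ?thesis unfolding eq using True by simp
  next
    case False
    have "sin x \<noteq> 0"
    proof
      assume "sin x = 0"
      then obtain i :: int where i: "x = of_int i * pi" by (auto simp: sin_zero_iff_int2)
      hence "pi * real n = pi * (real_of_int i * (2*real r+1))"
        unfolding x_def by (subst (asm) divide_eq_eq) (auto simp: mult_ac)
      hence "real n = real_of_int i * (2*real r+1)" by (simp only: mult_cancel_left) simp
      hence "real_of_int (int n) = real_of_int (i * (2*int r+1))" by simp
      hence "int n = i * int (2*r+1)" by (simp only: of_int_eq_iff) simp
      hence "int (2*r+1) dvd int n" by simp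
      thus False using False by (simp only: int_dvd_int_iff)
    qed
    moreover have "sin ((2 * real r + 1) * x) = 0"
      by (simp add: x_def sin_npi2 mult.commute add_pos_nonneg less_imp_neq[symmetric])
    ultimately show ?thesis unfolding eq using sin_times_dirichlet[of x r] False by simp
  qed
qed

lemma sum_multiples:
  fixes g :: "nat \<Rightarrow> real"
  assumes "l > 0" "\<And>n. n > m \<Longrightarrow> g n = 0"
  shows "(\<Sum>n=1..m. if l dvd n then g n else 0) = (\<Sum>k. g (Suc k * l))"
proof -
  have "(\<Sum>k. g (Suc k * l)) = (\<Sum>k<m. g (Suc k * l))"
  proof (rule suminf_finite)
    fix k assume "k \<notin> {..<m}"
    hence "Suc k * l > m" using assms(1) by (metis lessThan_iff not_less_eq mult_le_mono2 mult.right_neutral Suc_leI One_nat_def order_less_le_trans linorder_not_less)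
    thus "g (Suc k * l) = 0" by (rule assms)
  qed simp
  also have "\<dots> = (\<Sum>k\<in>{k. k < m \<and> Suc k * l \<le> m}. g (Suc k * l))"
    by (rule sum.mono_neutral_right) (auto intro: assms(2))
  also have "\<dots> = (\<Sum>n\<in>{n\<in>{1..m}. l dvd n}. g n)"
  proof (rule sum.reindex_bij_witness[of _ "\<lambda>n. n div l - 1" "\<lambda>k. Suc k * l"])
    fix n assume n: "n \<in> {n\<in>{1..m}. l dvd n}"
    then obtain k where k: "n = l * k" by auto
    then obtain k' where "k = Suc k'" using n by (cases k) auto
    with k have n_eq: "n = Suc k' * l" by simp
    hence "n div l - 1 = k'" using assms(1) by simp
    moreover have "k' < Suc k' * l" using assms(1) by (cases l) auto
    ultimately show "Suc (n div l - 1) * l = n" "n div l - 1 \<in> {k. k < m \<and> Suc k * l \<le> m}"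
      using n n_eq by simp_all
  qed (use assms in auto)
  also have "\<dots> = (\<Sum>n=1..m. if l dvd n then g n else 0)"
    by (rule sum.inter_filter) simp
  finally show ?thesis by simp
qed

text \<open>Expanding each cosine power by \<open>cos_power_even\<close> and exchanging the sums leaves, by orthogonality, only the
  binomial coefficients whose distance from the middle is a multiple of \<open>2 r + 1\<close>. The series on the right is
  finite, because binomial coefficients vanish beyond \<open>2 m\<close>; writing it as a series prepares the passage to the
  limit.\<close>

lemma discrete_poisson:
  fixes r m :: nat
  shows "1 + 2 * (\<Sum>j=1..r. cos (pi * real j / (2*real r+1)) ^ (2*m))
    = (2*real r+1) * (real ((2*m) choose m) / 4^m) *
        (1 + 2 * (\<Sum>k. real ((2*m) choose (m + Suc k * (2*r+1))) / real ((2*m) choose m)))"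
proof -
  define C where "C n = real ((2*m) choose (m+n))" for n
  define x where "x j = pi * real j / (2*real r+1)" for j
  have C0: "C 0 > 0" by (simp add: C_def)
  have "4^m * (1 + 2 * (\<Sum>j=1..r. cos (x j) ^ (2*m))) = 4^m * cos 0 ^(2*m) + 2 * (\<Sum>j=1..r. 4^m * cos (x j) ^ (2*m))"
    by (simp add: sum_distrib_left algebra_simps)
  also have "\<dots> = C 0 * (1 + 2 * (\<Sum>j=1..r. 1)) + 2 * (\<Sum>n=1..m. C n * (1 + 2 * (\<Sum>j=1..r. cos (2 * real n * x j))))"
    unfolding cos_power_even C_def[symmetric]
    apply (simp add: sum.distrib sum_distrib_left distrib_left C_def[of 0,simplified,symmetric])
    apply (subst sum.swap)
    apply (simp add: algebra_simps sum_distrib_left)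
    done
  also have "(\<Sum>n=1..m. C n * (1 + 2 * (\<Sum>j=1..r. cos (2 * real n * x j)))) 
     = (2*real r+1) * (\<Sum>n=1..m. if (2*r+1) dvd n then C n else 0)"
    unfolding x_def dirichlet_kernel_value by (simp add: sum_distrib_left if_distrib mult.commute cong: if_cong)
  also have "(\<Sum>n=1..m. if (2*r+1) dvd n then C n else 0) = (\<Sum>k. C (Suc k * (2*r+1)))"
    by (rule sum_multiples) (auto simp: C_def)
  also have "\<dots> = C 0 * (\<Sum>k. C (Suc k * (2*r+1)) / C 0)"
  proof -
    have "summable (\<lambda>k. C (Suc k * (2*r+1)))"
      by (rule summable_finite[of "{..<m}"]) (auto simp: C_def)
    thus ?thesis using C0 suminf_divide[of "\<lambda>k. C (Suc k * (2*r+1))" "C 0"] by simp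
  qed
  finally show ?thesis by (simp add: x_def C_def field_simps)
qed

section \<open>The Gaussian limit\<close>

lemma summable_gaussian:
  fixes c :: real
  assumes "c > 0"
  shows "summable (\<lambda>k. exp (- (c * (real (Suc k))^2)))"
proof (rule summable_comparison_test')
  show "summable (\<lambda>k. exp (-c) ^ k)"
    using assms by (intro summable_geometric) simp
  fix k :: nat
  have "real k \<le> (real (Suc k))^2" by (simp add: power2_eq_square algebra_simps)
  hence "c * real k \<le> c * (real (Suc k))^2" using assms by (intro mult_left_mono) auto
  thus "norm (exp (- (c * (real (Suc k))^2))) \<le> exp (-c) ^ k"
    by (simp add: exp_of_nat_mult[symmetric] mult.commute)
qed

lemma cos_power_gaussian_limit:
  fixes m :: "nat \<Rightarrow> nat" and u a :: real
  assumes "(\<lambda>r. real (m r) / (2*real r+1)^2) \<longlonglongrightarrow> u"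
  shows "(\<lambda>r. cos (a / (2*real r+1)) ^ (2 * m r)) \<longlonglongrightarrow> exp (- (u * a^2))"
proof (cases "a = 0")
  case False
  have "(\<lambda>r. (2*real r+1)^2 * ln (cos (a / (2*real r+1)))) \<longlonglongrightarrow> - (a^2/2)"
    using False by (cases "a > 0"; real_asymp; simp add: power2_eq_square)
  from tendsto_mult[OF tendsto_mult[OF tendsto_const[of 2] assms] this]
  have "(\<lambda>r. 2 * (real (m r) / (2*real r+1)^2) * ((2*real r+1)^2 * ln (cos (a / (2*real r+1))))) \<longlonglongrightarrow> - (u * a^2)"
    by (simp add: mult_ac)
  hence "(\<lambda>r. exp (2 * (real (m r) / (2*real r+1)^2) * ((2*real r+1)^2 * ln (cos (a / (2*real r+1)))))) \<longlonglongrightarrow> exp (- (u * a^2))"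
    by (rule tendsto_exp)
  moreover have "\<forall>\<^sub>F r in sequentially. exp (2 * (real (m r) / (2*real r+1)^2) * ((2*real r+1)^2 * ln (cos (a / (2*real r+1))))) = cos (a / (2*real r+1)) ^ (2 * m r)"
  proof -
    have "(\<lambda>r. cos (a / (2*real r+1))) \<longlonglongrightarrow> 1" by real_asymp
    hence "\<forall>\<^sub>F r in sequentially. cos (a / (2*real r+1)) > 0" by (rule order_tendstoD) simp
    thus ?thesis
    proof eventually_elim
      case (elim r)
      have "2*real r+1 > 0" by simp
      hence "2 * (real (m r) / (2*real r+1)^2) * ((2*real r+1)^2 * ln (cos (a / (2*real r+1)))) = real (2 * m r) * ln (cos (a / (2*real r+1)))"
        by simp
      thus ?case using elim by (simp only: exp_of_nat_mult exp_ln)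
    qed
  qed
  ultimately show ?thesis by (rule Lim_transform_eventually)
qed simp

text \<open>With \<open>l = 2 r + 1\<close> and \<open>n = K l\<close>, the exponents \<open>n^2 / (m + 1 - n)\<close> and \<open>n^2 / (m + n)\<close> of
  \<open>central_ratio_bounds\<close> both tend to \<open>K^2 / u\<close>, because \<open>n^2 / m\<close> does and \<open>n / m\<close> tends to 0.\<close>

lemma binomial_gaussian_limit:
  fixes m :: "nat \<Rightarrow> nat" and u :: real and K :: nat
  assumes lim: "(\<lambda>r. real (m r) / (2*real r+1)^2) \<longlonglongrightarrow> u" and "u > 0"
  shows "(\<lambda>r. real ((2 * m r) choose (m r + K * (2*r+1))) / real ((2 * m r) choose (m r)))
           \<longlonglongrightarrow> exp (- ((real K)^2 / u))"
proof -
  define l where "l r = 2*real r+1" for r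
  have l: "l r > 0" for r by (simp add: l_def)
  have l0: "(\<lambda>r. 1 / l r) \<longlonglongrightarrow> 0" unfolding l_def by real_asymp
  note lim' = lim[folded l_def]
  have "(\<lambda>r. (real K)^2 / (real (m r) / (l r)^2 + (1 / l r)^2 - real K * (1 / l r))) \<longlonglongrightarrow> (real K)^2 / (u + 0^2 - real K * 0)"
    using \<open>u > 0\<close> by (intro tendsto_intros lim' l0) simp
  hence lower: "(\<lambda>r. exp (- ((real K)^2 / (real (m r) / (l r)^2 + (1 / l r)^2 - real K * (1 / l r))))) \<longlonglongrightarrow> exp (- ((real K)^2 / u))"
    by (intro tendsto_exp tendsto_minus) simp
  have "(\<lambda>r. (real K)^2 / (real (m r) / (l r)^2 + real K * (1 / l r))) \<longlonglongrightarrow> (real K)^2 / (u + real K * 0)"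
    using \<open>u > 0\<close> by (intro tendsto_intros lim' l0) simp
  hence upper: "(\<lambda>r. exp (- ((real K)^2 / (real (m r) / (l r)^2 + real K * (1 / l r))))) \<longlonglongrightarrow> exp (- ((real K)^2 / u))"
    by (intro tendsto_exp tendsto_minus) simp
  have "(\<lambda>r. real (m r) / (l r)^2 - real K * (1 / l r)) \<longlonglongrightarrow> u - real K * 0"
    by (intro tendsto_intros lim' l0)
  hence ev: "\<forall>\<^sub>F r in sequentially. real (m r) / (l r)^2 - real K * (1 / l r) > 0"
    using \<open>u > 0\<close> by (intro order_tendstoD(1)) auto
  have bounds: "\<forall>\<^sub>F r in sequentially.
      exp (- ((real K)^2 / (real (m r) / (l r)^2 + (1 / l r)^2 - real K * (1 / l r)))) 
        \<le> real ((2 * m r) choose (m r + K * (2*r+1))) / real ((2 * m r) choose (m r)) \<and>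
      real ((2 * m r) choose (m r + K * (2*r+1))) / real ((2 * m r) choose (m r)) 
        \<le> exp (- ((real K)^2 / (real (m r) / (l r)^2 + real K * (1 / l r))))"
    using ev
  proof eventually_elim
    case (elim r)
    define n where "n = K * (2*r+1)"
    have rn: "real n = real K * l r" by (simp add: n_def l_def algebra_simps)
    have *: "real (m r) / (l r)^2 - real K * (1 / l r) = (real (m r) - real n) / (l r)^2"
      using l[of r] by (simp add: rn field_simps power2_eq_square)
    have "n \<le> m r"
      using elim l[of r] unfolding * by (simp add: zero_less_divide_iff)
    note b = central_ratio_bounds[OF this order.refl this]
    have "real (m r) / (l r)^2 + (1 / l r)^2 - real K * (1 / l r) = (real (m r) + 1 - real n) / (l r)^2"
      using l[of r] by (simp add: rn field_simps power2_eq_square)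
    moreover have "real (m r) / (l r)^2 + real K * (1 / l r) = (real (m r) + real n) / (l r)^2"
      using l[of r] by (simp add: rn field_simps power2_eq_square)
    moreover have "(real K)^2 / (x / (l r)^2) = (real n)^2 / x" for x
      by (simp add: rn power_mult_distrib)
    ultimately show ?case using b by (simp only: n_def)
  qed
  show ?thesis
    by (rule tendsto_sandwich[OF _ _ lower upper]) (use bounds in \<open>auto elim: eventually_mono\<close>)
qed

text \<open>This is the limit of \<open>discrete_poisson\<close> along \<open>m = \<lfloor>u * l^2\<rfloor>\<close>. Tannery's theorem justifies the
  exchange of limit and summation on both sides, and \<open>central_binomial_asymp\<close> provides the factor
  \<open>1 / sqrt (pi * u)\<close>.\<close>

lemma gaussian_poisson:
  fixes u :: real
  assumes u: "u > 0"
  shows "1 + 2 * (\<Sum>k. exp (- (u * (pi * real (Suc k))^2)))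
       = (1 + 2 * (\<Sum>k. exp (- ((real (Suc k))^2 / u)))) / sqrt (pi * u)"
proof -
  define l where "l r = 2*real r+1" for r
  define m where "m r = nat \<lfloor>u * (l r)^2\<rfloor>" for r
  have l: "l r > 0" for r by (simp add: l_def)
  have m_le: "real (m r) \<le> u * (l r)^2" for r
    using u by (simp add: m_def)
  have m_ge: "real (m r) \<ge> u * (l r)^2 - 1" for r
    using u by (simp add: m_def)
  have l0: "(\<lambda>r. 1 / l r) \<longlonglongrightarrow> 0" unfolding l_def by real_asymp
  have mlim: "(\<lambda>r. real (m r) / (l r)^2) \<longlonglongrightarrow> u"
  proof (rule tendsto_sandwich)
    have "(\<lambda>r. u - (1 / l r)^2) \<longlonglongrightarrow> u - 0^2"
      by (intro tendsto_intros l0)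
    thus "(\<lambda>r. u - (1 / l r)^2) \<longlonglongrightarrow> u" by simp
    show "\<forall>\<^sub>F r in sequentially. u - (1 / l r)^2 \<le> real (m r) / (l r)^2"
    proof (intro always_eventually allI)
      fix r
      have "u - (1 / l r)^2 = (u * (l r)^2 - 1) / (l r)^2"
        using l[of r] by (simp add: field_simps)
      also have "\<dots> \<le> real (m r) / (l r)^2" using m_ge[of r] by (intro divide_right_mono) auto
      finally show "u - (1 / l r)^2 \<le> real (m r) / (l r)^2" .
    qed
    show "\<forall>\<^sub>F r in sequentially. real (m r) / (l r)^2 \<le> u"
      using m_le l u by (intro always_eventually allI) (simp add: divide_le_eq)
  qed (rule tendsto_const)
  have minf: "filterlim m at_top sequentially"
  proof -
    have "filterlim (\<lambda>r. u * (l r)^2 - 1) at_top sequentially"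
      unfolding l_def using u by real_asymp
    hence "filterlim (\<lambda>r. real (m r)) at_top sequentially"
      by (rule filterlim_at_top_mono) (use m_ge in auto)
    thus ?thesis by (simp add: filterlim_sequentially_iff_filterlim_real)
  qed

  have cos_side: "(\<lambda>r. \<Sum>k. if k < r then cos (pi * real (Suc k) / l r) ^ (2 * m r) else 0)
        \<longlonglongrightarrow> (\<Sum>k. exp (- (u * (pi * real (Suc k))^2)))"
  proof (rule conjunct2[OF conjunct2[OF tannerys_theorem]])
    fix k
    have "(\<lambda>r. cos (pi * real (Suc k) / l r) ^ (2 * m r)) \<longlonglongrightarrow> exp (- (u * (pi * real (Suc k))^2))"
      unfolding l_def by (rule cos_power_gaussian_limit[OF mlim[unfolded l_def]])
    thus "(\<lambda>r. if k < r then cos (pi * real (Suc k) / l r) ^ (2 * m r) else 0) \<longlonglongrightarrow> exp (- (u * (pi * real (Suc k))^2))"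
      by (rule Lim_transform_eventually) (rule eventually_mono[OF eventually_gt_at_top[of k]], simp)
  next
    have "\<forall>\<^sub>F r in sequentially. real (m r) / (l r)^2 > u/2"
      using u by (intro order_tendstoD(1)[OF mlim]) auto
    from eventually_prodI[OF eventually_True[of at_top] this]
    have "\<forall>\<^sub>F (k,r) in at_top \<times>\<^sub>F sequentially. u/2 < real (m r) / (l r)^2"
      by (simp add: case_prod_unfold)
    thus "\<forall>\<^sub>F (k,r) in at_top \<times>\<^sub>F sequentially. 
        norm (if k < r then cos (pi * real (Suc k) / l r) ^ (2 * m r) else 0) \<le> exp (- ((u/3*pi^2) * (real (Suc k))^2))"
    proof (rule eventually_mono, clarify)
      fix k r assume *: "u/2 < real (m r) / (l r)^2"
      show "norm (if k < r then cos (pi * real (Suc k) / l r) ^ (2 * m r) else 0) \<le> exp (- ((u/3*pi^2) * (real (Suc k))^2))"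
      proof (cases "k < r")
        case True
        define x where "x = pi * real (Suc k) / l r"
        have x0: "0 \<le> x" using l[of r] by (simp add: x_def)
        have "real (Suc k) / l r \<le> 1/2"
          using True l[of r] by (simp add: l_def divide_le_eq)
        hence "pi * (real (Suc k) / l r) \<le> pi * (1/2)" by (intro mult_left_mono) auto
        hence x1: "x \<le> pi/2" by (simp add: x_def)
        have c0: "0 \<le> cos x" using x0 x1 by (intro cos_ge_zero) auto
        have "cos x ^ (2 * m r) \<le> exp (- (x^2/3)) ^ (2 * m r)"
          using x0 x1 pi_half_less_two c0 by (intro power_mono cos_le_exp) auto
        also have "\<dots> = exp (- ((2/3) * (real (m r) / (l r)^2) * (pi * real (Suc k))^2))"
          unfolding exp_of_nat_mult[symmetric] x_def
          by (simp add: power_divide mult_ac)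
        also have "\<dots> \<le> exp (- ((2/3) * (u/2) * (pi * real (Suc k))^2))"
        proof -
          have "(2/3) * (u/2) * (pi * real (Suc k))^2 \<le> (2/3) * (real (m r) / (l r)^2) * (pi * real (Suc k))^2"
            using * by (intro mult_right_mono mult_left_mono) auto
          thus ?thesis by (simp only: exp_le_cancel_iff neg_le_iff_le)
        qed
        also have "(2/3) * (u/2) * (pi * real (Suc k))^2 = (u/3*pi^2) * (real (Suc k))^2"
          by (simp add: power_mult_distrib)
        finally show ?thesis using True c0 by (simp add: x_def)
      qed simp
    qed
  next
    show "summable (\<lambda>k. exp (- ((u/3*pi^2) * (real (Suc k))^2)))"
      by (rule summable_gaussian) (use u in simp)
  qed simp

  have bin_side: "(\<lambda>r. \<Sum>k. real ((2 * m r) choose (m r + Suc k * (2*r+1))) / real ((2 * m r) choose (m r)))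
        \<longlonglongrightarrow> (\<Sum>k. exp (- ((real (Suc k))^2 / u)))"
  proof (rule conjunct2[OF conjunct2[OF tannerys_theorem]])
    fix k
    show "(\<lambda>r. real ((2 * m r) choose (m r + Suc k * (2*r+1))) / real ((2 * m r) choose (m r))) \<longlonglongrightarrow> exp (- ((real (Suc k))^2 / u))"
      by (rule binomial_gaussian_limit[OF mlim[unfolded l_def] u])
  next
    show "\<forall>\<^sub>F (k,r) in at_top \<times>\<^sub>F sequentially. 
        norm (real ((2 * m r) choose (m r + Suc k * (2*r+1))) / real ((2 * m r) choose (m r))) \<le> exp (- (1/(2*u) * (real (Suc k))^2))"
    proof (rule always_eventually, clarify)
      fix k r
      define n where "n = Suc k * (2*r+1)"
      show "norm (real ((2 * m r) choose (m r + Suc k * (2*r+1))) / real ((2 * m r) choose (m r))) \<le> exp (- (1/(2*u) * (real (Suc k))^2))"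
      proof (cases "n \<le> m r")
        case True
        have rn: "real n = real (Suc k) * l r" unfolding n_def l_def of_nat_mult by simp
        have n0: "n > 0" by (simp add: n_def)
        have "real ((2 * m r) choose (m r + n)) / real ((2 * m r) choose (m r)) \<le> exp (- ((real n)^2 / (real (m r) + real (m r))))"
          by (rule conjunct2[OF central_ratio_bounds[OF True True order.refl]])
        also have "\<dots> \<le> exp (- ((real n)^2 / (2 * (u * (l r)^2))))"
        proof -
          have "(real n)^2 / (2 * (u * (l r)^2)) \<le> (real n)^2 / (real (m r) + real (m r))"
            using m_le[of r] True n0 by (intro divide_left_mono) (auto intro!: mult_pos_pos u simp: l[of r] less_imp_neq[OF l, symmetric])
          thus ?thesis by (simp only: exp_le_cancel_iff neg_le_iff_le)
        qed
        also have "(real n)^2 / (2 * (u * (l r)^2)) = 1/(2*u) * (real (Suc k))^2"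
          using l[of r] by (simp add: rn power_mult_distrib del: of_nat_Suc)
        finally show ?thesis by (simp add: n_def)
      next
        case False
        hence eq: "(2 * m r) choose (m r + n) = 0" by simp
        show ?thesis unfolding n_def[symmetric] eq by simp
      qed
    qed
  next
    show "summable (\<lambda>k. exp (- (1/(2*u) * (real (Suc k))^2)))"
      by (rule summable_gaussian) (use u in simp)
  qed simp

  have const: "(\<lambda>r. l r * (real ((2 * m r) choose (m r)) / 4 ^ m r)) \<longlonglongrightarrow> 1 / sqrt (pi * u)"
  proof -
    have "(\<lambda>r. (real ((2 * m r) choose (m r)) / 4 ^ m r)^2 * (2 * real (m r) + 1)) \<longlonglongrightarrow> 2/pi"
      by (rule filterlim_compose[OF central_binomial_asymp minf])
    moreover have "(\<lambda>r. 1 / (2 * (real (m r) / (l r)^2) + (1 / l r)^2)) \<longlonglongrightarrow> 1 / (2 * u + 0^2)"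
      using u by (intro tendsto_intros mlim l0) simp
    ultimately have "(\<lambda>r. (real ((2 * m r) choose (m r)) / 4 ^ m r)^2 * (2 * real (m r) + 1) * (1 / (2 * (real (m r) / (l r)^2) + (1 / l r)^2)))
        \<longlonglongrightarrow> 2/pi * (1 / (2 * u + 0^2))"
      by (rule tendsto_mult)
    moreover have "(real ((2 * m r) choose (m r)) / 4 ^ m r)^2 * (2 * real (m r) + 1) * (1 / (2 * (real (m r) / (l r)^2) + (1 / l r)^2))
        = (l r * (real ((2 * m r) choose (m r)) / 4 ^ m r))^2" for r
    proof -
      have eq: "1 / (2 * (real (m r) / (l r)^2) + (1 / l r)^2) = (l r)^2 / (2 * real (m r) + 1)"
        using l[of r] by (simp add: power_divide add_divide_distrib[symmetric])
      have "X^2 * M * (Y^2 / M) = (Y * X)^2" if "M \<noteq> 0" for X Y M :: real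
        using that by (simp add: power_mult_distrib)
      moreover have "2 * real (m r) + 1 \<noteq> 0" by linarith
      ultimately show ?thesis unfolding eq by blast
    qed
    ultimately have "(\<lambda>r. (l r * (real ((2 * m r) choose (m r)) / 4 ^ m r))^2) \<longlonglongrightarrow> 1 / (pi * u)"
      by simp
    hence "(\<lambda>r. sqrt ((l r * (real ((2 * m r) choose (m r)) / 4 ^ m r))^2)) \<longlonglongrightarrow> sqrt (1 / (pi * u))"
      by (rule tendsto_real_sqrt)
    thus ?thesis using l by (simp add: real_sqrt_divide less_imp_le)
  qed

  have "1 + 2 * (\<Sum>k. if k < r then cos (pi * real (Suc k) / l r) ^ (2 * m r) else 0)
     = l r * (real ((2 * m r) choose (m r)) / 4 ^ m r) * 
       (1 + 2 * (\<Sum>k. real ((2 * m r) choose (m r + Suc k * (2*r+1))) / real ((2 * m r) choose (m r))))" for r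
  proof -
    have "(\<Sum>k. if k < r then cos (pi * real (Suc k) / l r) ^ (2 * m r) else 0) 
        = (\<Sum>k<r. cos (pi * real (Suc k) / l r) ^ (2 * m r))"
      by (subst suminf_finite[of "{..<r}"]) auto
    also have "\<dots> = (\<Sum>j=1..r. cos (pi * real j / l r) ^ (2 * m r))"
      by (simp add: sum.atLeast1_atMost_eq)
    finally show ?thesis using discrete_poisson[of r "m r"] by (simp only: l_def)
  qed
  moreover have "(\<lambda>r. 1 + 2 * (\<Sum>k. if k < r then cos (pi * real (Suc k) / l r) ^ (2 * m r) else 0))
     \<longlonglongrightarrow> 1 + 2 * (\<Sum>k. exp (- (u * (pi * real (Suc k))^2)))"
    by (intro tendsto_intros cos_side)
  moreover have "(\<lambda>r. l r * (real ((2 * m r) choose (m r)) / 4 ^ m r) * 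
       (1 + 2 * (\<Sum>k. real ((2 * m r) choose (m r + Suc k * (2*r+1))) / real ((2 * m r) choose (m r)))))
     \<longlonglongrightarrow> 1 / sqrt (pi * u) * (1 + 2 * (\<Sum>k. exp (- ((real (Suc k))^2 / u))))"
    by (intro tendsto_intros const bin_side)
  ultimately show ?thesis
    using LIMSEQ_unique by fastforce
qed

section \<open>The theta function on the upper half-plane\<close>

lemma theta_half_scale: "theta_half z \<epsilon> = theta_half (of_real \<epsilon> * z) 1"
  unfolding theta_half_def by (simp add: mult_ac)

text \<open>The substitution \<open>n \<mapsto> - n\<close> needs no summability: \<open>infsum\<close> is invariant under reindexing and
  commutes with negation even where it takes its default value 0.\<close>

lemma odd_theta_series_zero: "(\<Sum>\<^sub>\<infinity>n::int. of_int n * g (of_int n ^ 2 :: complex)) = (0 :: complex)"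
proof -
  let ?f = "\<lambda>n::int. of_int n * g (of_int n ^ 2 :: complex)"
  have "infsum ?f UNIV = infsum (\<lambda>n. ?f (- n)) UNIV"
    by (rule infsum_reindex_bij_betw[symmetric]) (auto intro!: bij_betwI[of _ _ _ uminus])
  also have "\<dots> = - infsum ?f UNIV"
    by (simp add: infsum_uminus)
  finally show ?thesis by (simp add: eq_neg_iff_add_eq_0)
qed

lemma norm_theta_term: "norm (exp (\<i> * of_real pi * of_int n ^ 2 * z)) = exp (- (pi * Im z * (real_of_int n)^2))"
proof -
  have "Re (\<i> * of_real pi * of_int n ^ 2 * z) = - (pi * Im z * (real_of_int n)^2)"
    by (simp flip: of_int_power)
  thus ?thesis by (simp only: norm_exp_eq_Re)
qed

lemma theta_term_summable:
  assumes "Im z > 0"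
  shows "summable (\<lambda>k. norm (exp (\<i> * of_real pi * of_int (int (Suc k)) ^ 2 * z)))"
  unfolding norm_theta_term unfolding of_int_of_nat_eq
  by (rule summable_gaussian) (use assms in simp)

text \<open>On the upper half-plane the unordered sum over \<open>int\<close> becomes an ordinary series, to which the theorems on
  uniform convergence and the Gaussian sums above apply.\<close>

lemma theta_half_nat:
  assumes "Im z > 0"
  shows "theta_half z 1 = 1 + 2 * (\<Sum>k. exp (\<i> * of_real pi * of_int (int (Suc k)) ^ 2 * z))"
proof -
  define f where "f = (\<lambda>n::int. exp (\<i> * of_real pi * of_int n ^ 2 * z))"
  define S where "S = (\<Sum>k. f (int (Suc k)))"
  have sm: "summable (\<lambda>k. norm (f (int (Suc k))))"
    using theta_term_summable[OF assms] by (simp only: f_def)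
  have hs: "((\<lambda>k. f (int (Suc k))) has_sum S) UNIV"
    unfolding S_def by (intro norm_summable_imp_has_sum sm summable_sums summable_norm_cancel[OF sm])
  have pos: "(f has_sum S) {0<..}"
  proof -
    have "bij_betw (\<lambda>k. int (Suc k)) UNIV {0<..}"
      by (rule bij_betwI[of _ _ _ "\<lambda>n. nat n - 1"]) auto
    from has_sum_reindex_bij_betw[OF this, of f S] hs show ?thesis by simp
  qed
  have neg: "(f has_sum S) {..<0}"
  proof -
    have b: "bij_betw uminus {0<..} {..<0::int}"
      by (rule bij_betwI[of _ _ _ uminus]) auto
    have "f (- n) = f n" for n by (simp add: f_def)
    with has_sum_reindex_bij_betw[OF b, of f S] pos show ?thesis by simp
  qed
  have "(f has_sum (S + S)) ({0<..} \<union> {..<0})"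
    by (rule has_sum_Un_disjoint[OF pos neg]) auto
  moreover have "(f has_sum 1) {0}"
    by (rule has_sum_finiteI) (simp_all add: f_def)
  ultimately have "(f has_sum (1 + (S + S))) ({0} \<union> ({0<..} \<union> {..<0}))"
    using has_sum_Un_disjoint[where f = f and A = "{0}" and B = "{0<..} \<union> {..<0}"] by auto
  moreover have "{0} \<union> ({0<..} \<union> {..<0}) = (UNIV :: int set)" by auto
  ultimately have "(f has_sum (1 + (S + S))) UNIV" by (simp only:)
  hence "infsum f UNIV = 1 + (S + S)" by (rule infsumI)
  thus ?thesis by (simp add: theta_half_def f_def S_def)
qed

text \<open>All terms have norm at least 1, so the family is not summable and \<open>infsum\<close> is 0 by convention.\<close>

lemma theta_half_divergent:
  assumes "Im z < 0"
  shows "theta_half z 1 = 0"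
proof -
  define f where "f = (\<lambda>n::int. exp (\<i> * of_real pi * of_int n ^ 2 * z))"
  have "\<not> f summable_on UNIV"
  proof
    assume "f summable_on UNIV"
    hence "f summable_on range int" by (rule summable_on_subset_banach) simp
    hence "(f \<circ> int) summable_on UNIV"
      by (subst (asm) summable_on_reindex) auto
    hence "summable (\<lambda>k. f (int k))"
      using summable_on_imp_summable[of "f \<circ> int"] by (simp add: o_def)
    hence "(\<lambda>k. f (int k)) \<longlonglongrightarrow> 0" by (rule summable_LIMSEQ_zero)
    hence "(\<lambda>k. norm (f (int k))) \<longlonglongrightarrow> 0" by (rule tendsto_norm_zero)
    hence "\<forall>\<^sub>F k in sequentially. norm (f (int k)) < 1" by (rule order_tendstoD) simp
    then obtain k where "norm (f (int k)) < 1" by (auto simp: eventually_sequentially)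
    moreover have "norm (f (int k)) \<ge> 1"
    proof -
      have "pi * Im z * (real_of_int (int k))^2 \<le> 0"
        using assms by (intro mult_nonpos_nonneg mult_nonneg_nonpos) simp_all
      thus ?thesis unfolding f_def norm_theta_term by simp
    qed
    ultimately show False by simp
  qed
  thus ?thesis
    using infsum_not_exists[of f UNIV] by (simp add: theta_half_def f_def)
qed

lemma theta_half_holomorphic: "(\<lambda>z. theta_half z 1) holomorphic_on {z. Im z > 0}"
proof -
  define f where "f k z = exp (\<i> * of_real pi * of_int (int (Suc k)) ^ 2 * z)" for k z
  define f' where "f' k z = f k z * (\<i> * of_real pi * of_int (int (Suc k)) ^ 2)" for k z
  have op: "open {z. Im z > 0}" by (rule open_halfspace_Im_gt)
  have "\<exists>g g'. \<forall>x\<in>{z. Im z > 0}. ((\<lambda>n. f n x) sums g x) \<and> ((\<lambda>n. f' n x) sums g' x) \<and> (g has_field_derivative g' x) (at x)"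
  proof (rule series_and_derivative_comparison_complex[OF op])
    show "(f n has_field_derivative f' n x) (at x)" for n x
      unfolding f_def f'_def by (rule derivative_eq_intros refl | simp)+
  next
    fix x :: complex assume "x \<in> {z. Im z > 0}"
    hence x: "Im x > 0" by simp
    define y where "y = Im x / 2"
    have y: "y > 0" using x by (simp add: y_def)
    define h where "h = (\<lambda>k. complex_of_real (exp (- (pi * y * (real (Suc k))^2))))"
    have "summable h"
      unfolding h_def summable_complex_of_real by (rule summable_gaussian) (use y in simp)
    moreover have "norm (f n w) \<le> norm (h n)" if "w \<in> ball x y" for n w
    proof -
      have "\<bar>Im (x - w)\<bar> \<le> norm (x - w)" by (rule abs_Im_le_cmod)
      also have "\<dots> < y" using that by (simp add: dist_norm)
      finally have "\<bar>Im x - Im w\<bar> < y" by simp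
      hence "Im w \<ge> y" using y_def by linarith
      hence "pi * y * (real (Suc n))^2 \<le> pi * Im w * (real (Suc n))^2"
        by (intro mult_right_mono mult_left_mono) auto
      thus ?thesis
        unfolding f_def norm_theta_term h_def norm_of_real by simp
    qed
    moreover have "range h \<subseteq> \<real>\<^sub>\<ge>\<^sub>0" by (auto simp: h_def)
    ultimately show "\<exists>d (h :: nat \<Rightarrow> complex). 0 < d \<and> summable h \<and> range h \<subseteq> \<real>\<^sub>\<ge>\<^sub>0 \<and>
        (\<forall>\<^sub>F n in sequentially. \<forall>w\<in>ball x d \<inter> {z. Im z > 0}. norm (f n w) \<le> norm (h n))"
      using y by (intro exI[of _ y] exI[of _ h]) (auto intro!: always_eventually)
  qed
  then obtain g g' where g: "\<And>x. Im x > 0 \<Longrightarrow> (\<lambda>n. f n x) sums g x"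
      "\<And>x. Im x > 0 \<Longrightarrow> (g has_field_derivative g' x) (at x)" by blast
  have "g holomorphic_on {z. Im z > 0}"
    unfolding holomorphic_on_open[OF op] using g(2) by auto
  hence "(\<lambda>z. 1 + 2 * g z) holomorphic_on {z. Im z > 0}"
    by (intro holomorphic_intros)
  moreover have "theta_half z 1 = 1 + 2 * g z" if "Im z > 0" for z
    using g(1)[OF that] theta_half_nat[OF that] by (simp add: f_def sums_iff)
  ultimately show ?thesis
    by (subst holomorphic_cong[OF refl, of _ _ "\<lambda>z. 1 + 2 * g z"]) auto
qed

lemma theta_half_imaginary:
  assumes "t > 0"
  shows "theta_half (\<i> * of_real t) 1 = of_real (1 + 2 * (\<Sum>k. exp (- (pi * t * (real (Suc k))^2))))"
proof -
  have "exp (\<i> * of_real pi * of_int (int (Suc k)) ^ 2 * (\<i> * of_real t)) = complex_of_real (exp (- (pi * t * (real (Suc k))^2)))" for k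
    by (simp add: exp_of_real[symmetric] mult_ac)
  moreover have sm: "summable (\<lambda>k. exp (- (pi * t * (real (Suc k))^2)))"
    by (rule summable_gaussian) (use assms in simp)
  ultimately show ?thesis
    using theta_half_nat[of "\<i> * of_real t"] assms by (simp only: suminf_of_real[OF sm, symmetric]) simp
qed

text \<open>On the imaginary axis this is \<open>gaussian_poisson\<close> with \<open>u = t / pi\<close>. Both sides are holomorphic, since
  \<open>-\<i> * z\<close> lies in the right half-plane, away from the branch cut.\<close>

lemma theta_half_inversion:
  assumes "Im z > 0"
  shows "theta_half (-1/z) 1 = csqrt (-\<i> * z) * theta_half z 1"
proof -
  let ?H = "{z. Im z > 0}"
  let ?F = "\<lambda>z. theta_half (-1/z) 1 - csqrt (-\<i> * z) * theta_half z 1"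
  have Im_inv: "Im (-1/z) > 0" if "Im z > 0" for z :: complex
  proof -
    from that have "(Re z)^2 + (Im z)^2 > 0" by (intro add_nonneg_pos) auto
    thus ?thesis using that by (simp add: Im_divide)
  qed
  have nz: "z \<noteq> 0" if "Im z > 0" for z :: complex using that by auto
  have "(\<lambda>z. theta_half z 1) \<circ> (\<lambda>z. -1/z) holomorphic_on ?H"
    by (rule holomorphic_on_compose_gen[OF _ theta_half_holomorphic])
       (use Im_inv nz in \<open>auto intro!: holomorphic_intros\<close>)
  moreover have "(\<lambda>z. csqrt (-\<i> * z)) holomorphic_on ?H"
    by (intro holomorphic_intros) (auto simp: complex_nonpos_Reals_iff)
  ultimately have hol: "?F holomorphic_on ?H"
    by (intro holomorphic_on_diff holomorphic_on_mult theta_half_holomorphic) (simp_all add: o_def)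
  have zero: "?F (\<i> * of_real t) = 0" if t: "t > 0" for t
  proof -
    have 1: "-1 / (\<i> * complex_of_real t) = \<i> * of_real (1/t)"
      using t by (simp add: field_simps)
    have "-\<i> * (\<i> * complex_of_real t) = of_real t" by (simp add: complex_eq_iff)
    hence 2: "csqrt (-\<i> * (\<i> * of_real t)) = of_real (sqrt t)"
      using t csqrt_of_real_nonneg[of "complex_of_real t"] by simp
    have "t / pi > 0" using t by simp
    from gaussian_poisson[OF this]
    have "1 + 2 * (\<Sum>k. exp (- (pi * t * (real (Suc k))^2))) 
       = (1 + 2 * (\<Sum>k. exp (- (pi * (1/t) * (real (Suc k))^2)))) / sqrt t"
      by (simp add: power_mult_distrib power2_eq_square mult_ac)
    hence "1 + 2 * (\<Sum>k. exp (- (pi * (1/t) * (real (Suc k))^2))) = sqrt t * (1 + 2 * (\<Sum>k. exp (- (pi * t * (real (Suc k))^2))))"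
      using t by (simp add: field_simps)
    moreover have "1/t > 0" using t by simp
    ultimately show ?thesis
      unfolding 1 2 theta_half_imaginary[OF t] theta_half_imaginary[OF \<open>1/t > 0\<close>]
      by (simp only: of_real_mult[symmetric]) simp
  qed
  have "?F z = 0"
  proof (rule analytic_continuation[OF hol _ _ _ _ _ _ ])
    show "open ?H" by (rule open_halfspace_Im_gt)
    show "connected ?H" by (intro convex_connected convex_halfspace_Im_gt)
    let ?U = "(\<lambda>t. \<i> * of_real t) ` {0<..}"
    show "?U \<subseteq> ?H" by auto
    show "\<i> \<in> ?H" by simp
    show "\<i> islimpt ?U"
    proof -
      have "(\<lambda>n. \<i> * of_real (1 + 1 / real (Suc n))) \<longlonglongrightarrow> \<i> * of_real (1 + 0)"
        by (intro tendsto_intros LIMSEQ_inverse_real_of_nat[unfolded inverse_eq_divide])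
      moreover have "\<i> * of_real (1 + 1 / real (Suc n)) \<in> ?U - {\<i>}" for n
      proof -
        have "\<i> * of_real (1 + 1 / real (Suc n)) \<noteq> \<i>"
          by (simp add: complex_eq_iff del: of_nat_Suc)
        moreover have "1 + 1 / real (Suc n) > 0" by (simp add: add_pos_pos)
        ultimately show ?thesis by blast
      qed
      ultimately show ?thesis
        unfolding islimpt_sequential by (intro exI[of _ "\<lambda>n. \<i> * of_real (1 + 1 / real (Suc n))"]) auto
    qed
    show "?F w = 0" if "w \<in> ?U" for w using that zero by auto
  qed (use assms in auto)
  thus ?thesis by simp
qed

section \<open>Moebius transformations and branches of the square root\<close>

lemma Im_moebius:
  fixes a b c d :: real
  shows "Im ((of_real a * z + of_real b) / (of_real c * z + of_real d)) =
           (a * d - b * c) * Im z / (cmod (of_real c * z + of_real d))^2"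
  by (simp add: Im_divide cmod_power2 algebra_simps)

lemma linear_nonzero:
  fixes c d :: real
  assumes "Im z \<noteq> 0" "c \<noteq> 0 \<or> d \<noteq> 0"
  shows "of_real c * z + of_real d \<noteq> 0"
  using assms by (auto simp: complex_eq_iff)

text \<open>The quotient \<open>f / g\<close> is continuous and takes at most the two values \<open>\<plusminus> csqrt \<kappa>\<close>.\<close>

lemma square_proportional_imp_proportional:
  fixes f g :: "complex \<Rightarrow> complex"
  assumes "connected S" "continuous_on S f" "continuous_on S g"
    and nz: "\<And>z. z \<in> S \<Longrightarrow> g z \<noteq> 0"
    and sq: "\<And>z. z \<in> S \<Longrightarrow> f z ^ 2 = \<kappa> * g z ^ 2"
  shows "\<exists>L. \<forall>z\<in>S. f z = L * g z"
proof -
  have "(\<lambda>z. f z / g z) constant_on S"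
  proof (rule continuous_finite_range_constant)
    show "continuous_on S (\<lambda>z. f z / g z)"
      using assms by (intro continuous_on_divide) auto
    have "f z / g z \<in> {csqrt \<kappa>, - csqrt \<kappa>}" if "z \<in> S" for z
    proof -
      have "(f z / g z)^2 = (csqrt \<kappa>)^2"
        using nz[OF that] sq[OF that] by (simp add: power_divide)
      thus ?thesis by (simp only: power2_eq_iff) simp
    qed
    hence "(\<lambda>z. f z / g z) ` S \<subseteq> {csqrt \<kappa>, - csqrt \<kappa>}" by blast
    thus "finite ((\<lambda>z. f z / g z) ` S)" by (rule finite_subset) simp
  qed fact
  then obtain L where "\<And>z. z \<in> S \<Longrightarrow> f z / g z = L" by (auto simp: constant_on_def)
  hence "f z = L * g z" if "z \<in> S" for z
    using that nz[OF that] by (metis nonzero_eq_divide_eq)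
  thus ?thesis by blast
qed

lemma linear_not_nonpos_Reals:
  fixes c d :: real
  assumes "Im z \<noteq> 0" "c \<noteq> 0"
  shows "of_real c * z + of_real d \<notin> \<real>\<^sub>\<le>\<^sub>0"
  using assms by (simp add: complex_nonpos_Reals_iff)

text \<open>On the union of both half-planes: if \<open>c = 0\<close> the function is constant, and otherwise its argument is never
  real.\<close>

lemma continuous_on_csqrt_linear:
  fixes c d :: real
  shows "continuous_on {z. Im z \<noteq> 0} (\<lambda>z. csqrt (of_real c * z + of_real d))"
proof (cases "c = 0")
  case False
  have "(\<lambda>z. csqrt (of_real c * z + of_real d)) holomorphic_on {z. Im z \<noteq> 0}"
    by (intro holomorphic_intros) (use linear_not_nonpos_Reals False in auto)
  thus ?thesis by (rule holomorphic_on_imp_continuous_on)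
qed simp

lemma sqrt_pm_squared: "sqrt_pm w ^ 2 = w"
  by (simp add: sqrt_pm_def)

lemma continuous_on_sqrt_pm_linear:
  fixes c d :: real
  shows "continuous_on {z. Im z \<noteq> 0} (\<lambda>z. sqrt_pm (of_real c * z + of_real d))"
proof (cases "c = 0")
  case False
  have "of_real c * z + of_real d \<noteq> -1" if "Im z \<noteq> 0" for z
    using that False by (auto simp: complex_eq_iff)
  hence "sqrt_pm (of_real c * z + of_real d) = csqrt (of_real c * z + of_real d)" if "Im z \<noteq> 0" for z
    using that by (simp add: sqrt_pm_def)
  thus ?thesis
    using continuous_on_csqrt_linear[of c d] by (subst continuous_on_cong[OF refl]) auto
qed simp

section \<open>The transformation law for the theta group\<close>

lemma theta_half_periodic: "theta_half (z + of_int (2 * k)) 1 = theta_half z 1"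
proof -
  have "exp (\<i> * of_real pi * of_int n ^ 2 * (z + of_int (2 * k))) = exp (\<i> * of_real pi * of_int n ^ 2 * z)" for n :: int
  proof -
    have "exp (\<i> * of_real pi * of_int n ^ 2 * (z + of_int (2 * k)))
        = exp (\<i> * of_real pi * of_int n ^ 2 * z) * exp (2 * of_int (n^2 * k) * of_real pi * \<i>)"
      by (simp add: exp_add[symmetric] algebra_simps)
    also have "exp (2 * of_int (n^2 * k) * of_real pi * \<i>) = (1 :: complex)"
      using exp_integer_2pi[OF Ints_of_int[of "n^2 * k"]] by (simp add: mult_ac)
    finally show ?thesis by simp
  qed
  thus ?thesis by (simp add: theta_half_def)
qed

lemma centered_residue:
  fixes a c :: int
  assumes "c \<noteq> 0"
  shows "\<exists>k. \<bar>a + 2 * k * c\<bar> \<le> \<bar>c\<bar>"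
proof -
  define q where "q = (a + \<bar>c\<bar>) div (2 * \<bar>c\<bar>)"
  have "a + \<bar>c\<bar> = 2 * \<bar>c\<bar> * q + (a + \<bar>c\<bar>) mod (2 * \<bar>c\<bar>)"
    by (simp add: q_def)
  moreover have "0 \<le> (a + \<bar>c\<bar>) mod (2 * \<bar>c\<bar>)" "(a + \<bar>c\<bar>) mod (2 * \<bar>c\<bar>) < 2 * \<bar>c\<bar>"
    using assms by simp_all
  ultimately have "\<bar>a - 2 * \<bar>c\<bar> * q\<bar> \<le> \<bar>c\<bar>" by linarith
  moreover have "a - 2 * \<bar>c\<bar> * q = a + 2 * (- sgn c * q) * c"
    by (simp add: abs_sgn)
  ultimately show ?thesis by metis
qed

text \<open>Adding \<open>2 k\<close> times the lower row to the upper row changes the argument of \<open>theta_half\<close> by its period and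
  makes \<open>\<bar>a\<bar> \<le> \<bar>c\<bar>\<close>. Equality is impossible: as \<open>a\<close> and \<open>c\<close> are coprime it would force
  \<open>\<bar>a\<bar> = \<bar>c\<bar> = 1\<close>, whereas one of the two entries is even. This is where the parity condition enters; it also
  makes \<open>b\<close> even when \<open>c = 0\<close>. Applying \<open>z \<mapsto> -1/z\<close> then moves the smaller entry \<open>a\<close> to the place
  of \<open>c\<close>.\<close>

lemma theta_half_moebius:
  fixes a b c d :: int
  assumes "a * d - b * c = 1"
    and "(even b \<and> even c) \<or> (even a \<and> even d)"
  shows "\<exists>L. \<forall>z. Im z > 0 \<longrightarrow>
    theta_half ((of_int a * z + of_int b) / (of_int c * z + of_int d)) 1 =
      L * csqrt (of_int c * z + of_int d) * theta_half z 1"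
  using assms
proof (induction "nat \<bar>c\<bar>" arbitrary: a b c d rule: less_induct)
  case less
  show ?case
  proof (cases "c = 0")
    case True
    with less.prems have ad: "a * d = 1" by simp
    hence d: "d = a" "a = 1 \<or> a = -1" by (auto simp: zmult_eq_1_iff)
    hence "even b" using less.prems(2) by auto
    then obtain k where k: "b = 2 * k" by auto
    have "theta_half ((of_int a * z + of_int b) / (of_int c * z + of_int d)) 1 = theta_half z 1" for z
    proof -
      have "(of_int a * z + of_int b) / (of_int c * z + of_int d) = z + of_int (2 * (a * k))"
        using d True k by (auto simp: field_simps)
      thus ?thesis by (simp only: theta_half_periodic)
    qed
    moreover have "csqrt (of_int d) \<noteq> 0" using d by auto
    ultimately show ?thesis using True
      by (intro exI[of _ "1 / csqrt (of_int d)"]) simp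
  next
    case False
    then obtain k where k: "\<bar>a + 2 * k * c\<bar> \<le> \<bar>c\<bar>" using centered_residue by blast
    define a' b' where "a' = a + 2 * k * c" and "b' = b + 2 * k * d"
    have det: "a' * d - b' * c = 1"
      using less.prems(1) by (simp add: a'_def b'_def algebra_simps)
    have par: "(even b' \<and> even c) \<or> (even a' \<and> even d)"
      using less.prems(2) by (auto simp: a'_def b'_def)
    have "\<bar>a'\<bar> \<noteq> \<bar>c\<bar>"
    proof
      assume eq: "\<bar>a'\<bar> = \<bar>c\<bar>"
      hence "c dvd a'" by (metis dvd_refl dvd_abs_iff abs_dvd_iff)
      hence "c dvd a' * d - b' * c" by simp
      hence "\<bar>c\<bar> = 1" using det by simp
      hence "odd c" "odd a'" using eq by presburger+
      thus False using par by blast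
    qed
    hence lt: "nat \<bar>a'\<bar> < nat \<bar>c\<bar>" using k False by (simp add: a'_def)
    (* The action of the matrix after reduction and inversion; its lower left entry is a'. *)
    define w where "w z = (of_int (-c) * z + of_int (-d)) / (of_int a' * z + of_int b')" for z :: complex
    have "(-c) * b' - (-d) * a' = 1" using det by (simp add: algebra_simps)
    moreover have "(even (-d) \<and> even a') \<or> (even (-c) \<and> even b')" using par by auto
    ultimately obtain L where L: "\<And>z. Im z > 0 \<Longrightarrow> 
        theta_half (w z) 1 = L * csqrt (of_int a' * z + of_int b') * theta_half z 1"
      using less.hyps[OF lt, of "-c" b' "-d"] unfolding w_def by blast
    have "a' \<noteq> 0 \<or> b' \<noteq> 0" using det by auto
    hence den1: "of_int a' * z + of_int b' \<noteq> 0" if "Im z > 0" for z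
      using linear_nonzero[of z "of_int a'" "of_int b'"] that by simp
    have den2: "of_int c * z + of_int d \<noteq> 0" if "Im z > 0" for z
      using linear_nonzero[of z "of_int c" "of_int d"] that False by simp
    have Imw: "Im (w z) > 0" if "Im z > 0" for z
    proof -
      have "Im (w z) = (real_of_int (-c) * of_int b' - of_int (-d) * of_int a') * Im z / (cmod (of_int a' * z + of_int b'))^2"
        using Im_moebius[of "of_int (-c)" z "of_int (-d)" "of_int a'" "of_int b'"]
        by (simp only: w_def of_real_of_int_eq)
      also have "real_of_int (-c) * of_int b' - of_int (-d) * of_int a' = of_int (a' * d - b' * c)"
        by simp
      finally show ?thesis using that den1[OF that] det by simp
    qed
    (* The squares are proportional because - i * w z * (a' * z + b') = i * (c * z + d). *)
    have "\<exists>M. \<forall>z\<in>{z. Im z > 0}. csqrt (-\<i> * w z) * csqrt (of_int a' * z + of_int b') = M * csqrt (of_int c * z + of_int d)"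
    proof (rule square_proportional_imp_proportional[where \<kappa> = \<i>])
      show "connected {z. Im z > 0}" by (intro convex_connected convex_halfspace_Im_gt)
      have lin: "continuous_on {z. Im z > 0} (\<lambda>z. csqrt (of_int x * z + of_int y))" for x y :: int
      proof -
        have "continuous_on {z. Im z > 0} (\<lambda>z. csqrt (of_real (of_int x) * z + of_real (of_int y)))"
          by (rule continuous_on_subset[OF continuous_on_csqrt_linear]) auto
        thus ?thesis by simp
      qed
      have "w holomorphic_on {z. Im z > 0}"
        unfolding w_def using den1 by (intro holomorphic_intros) auto
      hence "(\<lambda>z. csqrt (-\<i> * w z)) holomorphic_on {z. Im z > 0}"
        using Imw by (intro holomorphic_on_csqrt' holomorphic_on_mult holomorphic_on_const) (force simp: complex_nonpos_Reals_iff)+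
      thus "continuous_on {z. Im z > 0} (\<lambda>z. csqrt (-\<i> * w z) * csqrt (of_int a' * z + of_int b'))"
        by (intro continuous_on_mult lin holomorphic_on_imp_continuous_on)
      show "continuous_on {z. Im z > 0} (\<lambda>z. csqrt (of_int c * z + of_int d))" by (rule lin)
      show "csqrt (of_int c * z + of_int d) \<noteq> 0" if "z \<in> {z. Im z > 0}" for z
        using den2[of z] that by simp
      show "(csqrt (-\<i> * w z) * csqrt (of_int a' * z + of_int b'))^2 = \<i> * (csqrt (of_int c * z + of_int d))^2"
        if "z \<in> {z. Im z > 0}" for z
        using den1[of z] that by (simp add: power_mult_distrib w_def field_simps)
    qed
    then obtain M where M: "\<And>z. Im z > 0 \<Longrightarrow> csqrt (-\<i> * w z) * csqrt (of_int a' * z + of_int b') = M * csqrt (of_int c * z + of_int d)"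
      by blast
    have "theta_half ((of_int a * z + of_int b) / (of_int c * z + of_int d)) 1 = L * M * csqrt (of_int c * z + of_int d) * theta_half z 1"
      if z: "Im z > 0" for z
    proof -
      have neg: "of_int (-c) * z + of_int (-d) = - (of_int c * z + of_int d)" by simp
      have "-1 / w z = (of_int a' * z + of_int b') / (of_int c * z + of_int d)"
        unfolding w_def neg by (simp only: divide_divide_eq_right divide_minus_right minus_divide_left minus_minus mult_minus_left mult_1_left mult_minus_right minus_divide_divide)
      also have "\<dots> = (of_int a * z + of_int b) / (of_int c * z + of_int d) + of_int (2 * k)"
        using den2[OF z] by (simp add: a'_def b'_def field_simps)
      finally have "theta_half ((of_int a * z + of_int b) / (of_int c * z + of_int d)) 1 = theta_half (-1 / w z) 1"
        by (simp only: theta_half_periodic)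
      also have "\<dots> = csqrt (-\<i> * w z) * (L * csqrt (of_int a' * z + of_int b') * theta_half z 1)"
        using theta_half_inversion[OF Imw[OF z]] L[OF z] by (simp only:)
      also have "\<dots> = L * (csqrt (-\<i> * w z) * csqrt (of_int a' * z + of_int b')) * theta_half z 1"
        by (simp only: mult_ac)
      finally show ?thesis unfolding M[OF z] by (simp only: mult_ac)
    qed
    thus ?thesis by blast
  qed
qed

section \<open>Integrality and parity of the elements of the group\<close>

lemma mat2_eq_iff: "mat2 a b c d = mat2 a' b' c' d' \<longleftrightarrow> a = a' \<and> b = b' \<and> c = c' \<and> d = d'"
  by (auto simp: mat2_def vec_eq_iff forall_2)

lemma mat2_eta: "g = mat2 (g $ 1 $ 1) (g $ 1 $ 2) (g $ 2 $ 1) (g $ 2 $ 2)"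
  by (simp add: mat2_def vec_eq_iff forall_2)

lemma det_mat2: "det (mat2 a b c d) = a * d - b * c"
  by (simp add: mat2_def det_2)

lemma mat2_mult: "mat2 a b c d ** mat2 a' b' c' d' =
    mat2 (a * a' + b * c') (a * b' + b * d') (c * a' + d * c') (c * b' + d * d')"
  by (simp add: mat2_def matrix_matrix_mult_def vec_eq_iff forall_2 sum_2)

lemma mat2_one: "mat 1 = mat2 1 0 0 1"
  by (simp add: mat2_def mat_def vec_eq_iff forall_2)

text \<open>The integral matrices of determinant \<open>\<plusminus> 1\<close> that reduce modulo 2 to the identity or to \<open>omega\<close>. The odd
  determinant forces the entries not constrained to be even to be odd.\<close>

definition theta_group_pm :: "(real ^ 2 ^ 2) set" where
  "theta_group_pm = {mat2 (of_int a) (of_int b) (of_int c) (of_int d) | a b c d :: int.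
     (a * d - b * c = 1 \<or> a * d - b * c = -1) \<and> ((even b \<and> even c) \<or> (even a \<and> even d))}"

lemma theta_group_pmI:
  fixes a b c d :: int
  assumes "a * d - b * c = 1 \<or> a * d - b * c = -1" "(even b \<and> even c) \<or> (even a \<and> even d)"
  shows "mat2 (of_int a) (of_int b) (of_int c) (of_int d) \<in> theta_group_pm"
  using assms unfolding theta_group_pm_def by blast

lemma theta_group_pm_carrier: "theta_group_pm \<subseteq> carrier SL2pm_R"
proof
  fix g assume "g \<in> theta_group_pm"
  then obtain a b c d :: int where g: "g = mat2 (of_int a) (of_int b) (of_int c) (of_int d)" 
      "a * d - b * c = 1 \<or> a * d - b * c = -1" by (auto simp: theta_group_pm_def)
  have "det g = of_int (a * d - b * c)" by (simp add: g(1) det_mat2)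
  hence "det g = 1 \<or> det g = -1" using g(2) by (elim disjE) (simp_all only: of_int_1 of_int_minus simp_thms)
  thus "g \<in> carrier SL2pm_R" by (simp add: SL2pm_R_def)
qed

lemma theta_group_pm_subgroup: "subgroup theta_group_pm SL2pm_R"
proof -
  interpret group SL2pm_R by (rule group_SL2pm_R)
  show ?thesis
  proof (rule subgroupI)
    show "theta_group_pm \<subseteq> carrier SL2pm_R" by (rule theta_group_pm_carrier)
    have "mat2 (of_int 1) (of_int 0) (of_int 0) (of_int 1) \<in> theta_group_pm"
      by (rule theta_group_pmI) auto
    thus "theta_group_pm \<noteq> {}" by auto
  next
    fix g assume g: "g \<in> theta_group_pm"
    then obtain a b c d :: int where gg: "g = mat2 (of_int a) (of_int b) (of_int c) (of_int d)" 
        "a * d - b * c = 1 \<or> a * d - b * c = -1" "(even b \<and> even c) \<or> (even a \<and> even d)"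
      by (auto simp: theta_group_pm_def)
    define e where "e = a * d - b * c"
    have ee: "e * e = 1" "e = 1 \<or> e = -1" using gg(2) by (auto simp: e_def)
    define h where "h = mat2 (of_int (e * d)) (of_int (- (e * b))) (of_int (- (e * c))) (of_int (e * a))"
    have "e * d * (e * a) - (- (e * b)) * (- (e * c)) = (e * e) * e"
      by (simp add: e_def algebra_simps)
    hence "e * d * (e * a) - (- (e * b)) * (- (e * c)) = 1 \<or> e * d * (e * a) - (- (e * b)) * (- (e * c)) = -1"
      using ee by auto
    moreover have "(even (- (e * b)) \<and> even (- (e * c))) \<or> (even (e * d) \<and> even (e * a))"
      using gg(3) by auto
    ultimately have h: "h \<in> theta_group_pm"
      unfolding theta_group_pm_def h_def by blast
    have "e * (d * a - b * c) = 1" using ee(1) by (simp add: e_def mult.commute)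
    hence "real_of_int (e * (d * a - b * c)) = 1" by (simp only: of_int_1)
    hence "h ** g = mat2 1 0 0 1"
      unfolding h_def gg(1) mat2_mult mat2_eq_iff by (simp add: algebra_simps)
    hence "inv\<^bsub>SL2pm_R\<^esub> g = h"
      using g h theta_group_pm_carrier by (intro inv_equality) (auto simp: SL2pm_R_def mat2_one)
    thus "inv\<^bsub>SL2pm_R\<^esub> g \<in> theta_group_pm" using h by simp
  next
    fix g h assume "g \<in> theta_group_pm" "h \<in> theta_group_pm"
    then obtain a b c d a' b' c' d' :: int where 
      g: "g = mat2 (of_int a) (of_int b) (of_int c) (of_int d)" 
        "a * d - b * c = 1 \<or> a * d - b * c = -1" "(even b \<and> even c) \<or> (even a \<and> even d)" and
      h: "h = mat2 (of_int a') (of_int b') (of_int c') (of_int d')" 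
        "a' * d' - b' * c' = 1 \<or> a' * d' - b' * c' = -1" "(even b' \<and> even c') \<or> (even a' \<and> even d')"
      by (auto simp: theta_group_pm_def)
    have "(a * a' + b * c') * (c * b' + d * d') - (a * b' + b * d') * (c * a' + d * c') 
        = (a * d - b * c) * (a' * d' - b' * c')"
      by (simp add: algebra_simps)
    hence "(a * a' + b * c') * (c * b' + d * d') - (a * b' + b * d') * (c * a' + d * c') = 1 \<or>
      (a * a' + b * c') * (c * b' + d * d') - (a * b' + b * d') * (c * a' + d * c') = -1"
      using g(2) h(2) by auto
    moreover have "(even (a * b' + b * d') \<and> even (c * a' + d * c')) \<or> (even (a * a' + b * c') \<and> even (c * b' + d * d'))"
      using g(3) h(3) by auto
    moreover have "g ** h = mat2 (of_int (a * a' + b * c')) (of_int (a * b' + b * d')) (of_int (c * a' + d * c')) (of_int (c * b' + d * d'))"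
      by (simp add: g(1) h(1) mat2_mult)
    ultimately have "g ** h \<in> theta_group_pm"
      unfolding theta_group_pm_def by blast
    thus "g \<otimes>\<^bsub>SL2pm_R\<^esub> h \<in> theta_group_pm" by (simp add: SL2pm_R_def)
  qed
qed

lemma Gamma2pm_subset: "Gamma2pm \<subseteq> theta_group_pm"
proof
  fix g assume g: "g \<in> Gamma2pm"
  hence "\<forall>i j. \<exists>k::int. (g - mat 1) $ i $ j = 2 * of_int k" by (simp add: Gamma2pm_def)
  then obtain k :: "2 \<Rightarrow> 2 \<Rightarrow> int" where k: "\<And>i j. (g - mat 1) $ i $ j = 2 * of_int (k i j)" by metis
  define a b c d where "a = 2 * k 1 1 + 1" "b = 2 * k 1 2" "c = 2 * k 2 1" "d = 2 * k 2 2 + 1"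
  have g_eq: "g = mat2 (of_int a) (of_int b) (of_int c) (of_int d)"
    using k[of 1 1] k[of 1 2] k[of 2 1] k[of 2 2]
    by (subst mat2_eta, unfold mat2_eq_iff) (simp add: a_b_c_d_def mat_def algebra_simps)
  have "det g = 1 \<or> det g = -1"
    using g by (simp add: Gamma2pm_def SL2pm_Z_def SL2pm_R_def)
  hence "real_of_int (a * d - b * c) = real_of_int 1 \<or> real_of_int (a * d - b * c) = real_of_int (-1)"
    by (simp add: g_eq det_mat2)
  hence "a * d - b * c = 1 \<or> a * d - b * c = -1" by (simp only: of_int_eq_iff)
  moreover have "even b \<and> even c" by (simp add: a_b_c_d_def)
  ultimately show "g \<in> theta_group_pm"
    unfolding theta_group_pm_def g_eq by blast
qed

lemma Gamma_grp_subset: "Gamma_grp \<subseteq> theta_group_pm"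
proof -
  have "mat2 (of_int 0) (of_int (-1)) (of_int 1) (of_int 0) \<in> theta_group_pm"
    by (rule theta_group_pmI) auto
  hence "omega \<in> theta_group_pm" by (simp add: omega_def)
  thus ?thesis
    unfolding Gamma_grp_def
    using Gamma2pm_subset
    by (intro group.generate_subgroup_incl[OF group_SL2pm_R _ theta_group_pm_subgroup]) auto
qed

section \<open>The transformation law for matrices of determinant 1 and -1\<close>

theorem mainTheorem3:
  fixes a b c d :: real and \<gamma> :: "real ^ 2 ^ 2" and \<epsilon> :: real
  assumes "\<gamma> = mat2 a b c d"
    and "(\<epsilon> = 1 \<and> \<gamma> \<in> Gamma_grp) \<or>
         (\<epsilon> = -1 \<and> \<gamma> \<in> Gamma_grp - {mat2 (-1) 0 0 (-1), mat2 (-1) 0 0 1})"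
  shows "\<exists>L::complex. \<forall>z\<in>Hpm.
    theta_half ((of_real a * z + of_real b) / (of_real c * z + of_real d)) \<epsilon> =
      L * sqrt_pm (of_real (det \<gamma>) * (of_real c * z + of_real d)) *
      (\<Sum>\<^sub>\<infinity>n::int. exp (\<i> * of_real (det \<gamma>) * of_real \<epsilon> * of_real pi * of_int n ^ 2 * z)) \<and>
    theta_three_half ((of_real a * z + of_real b) / (of_real c * z + of_real d)) \<epsilon> =
      L * sqrt_pm (of_real (det \<gamma>) * (of_real c * z + of_real d)) ^ 3 *
      (\<Sum>\<^sub>\<infinity>n::int. of_int n * exp (\<i> * of_real (det \<gamma>) * of_real \<epsilon> * of_real pi * of_int n ^ 2 * z))"
proof -
  have "\<gamma> \<in> theta_group_pm" using assms(2) Gamma_grp_subset by auto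
  then obtain a' b' c' d' :: int where eqs: "a = of_int a'" "b = of_int b'" "c = of_int c'" "d = of_int d'"
      and det': "a' * d' - b' * c' = 1 \<or> a' * d' - b' * c' = -1"
      and par: "(even b' \<and> even c') \<or> (even a' \<and> even d')"
    unfolding theta_group_pm_def assms(1) by (auto simp: mat2_eq_iff)
  define D where "D = a' * d' - b' * c'"
  have D: "D = 1 \<or> D = -1" using det' by (simp add: D_def)
  have detD: "det \<gamma> = of_int D" by (simp add: assms(1) det_mat2 eqs D_def)
  obtain e :: int where e: "\<epsilon> = of_int e" "e = 1 \<or> e = -1"
    using assms(2) by (metis of_int_1 of_int_minus)
  have sq1: "D * D = 1" "e * e = 1" using D e by auto
  have cd: "c \<noteq> 0 \<or> d \<noteq> 0" using det' by (auto simp: eqs)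
  have De: "D * e = 1 \<or> D * e = -1" using D e by auto
  let ?S = "{z. of_int (D * e) * Im z > 0}"

  (* The matrix that maps D * e * z to e * (a * z + b) / (c * z + d). *)
  have "(a' * D) * d' - (e * b') * (c' * D * e) = 1"
  proof -
    have "(a' * D) * d' - (e * b') * (c' * D * e) = D * (a' * d' - (e * e) * (b' * c'))"
      by (simp add: algebra_simps)
    thus ?thesis using sq1 by (simp add: D_def)
  qed
  moreover have "(even (e * b') \<and> even (c' * D * e)) \<or> (even (a' * D) \<and> even d')"
    using par by auto
  ultimately obtain L where L: "\<And>z. Im z > 0 \<Longrightarrow>
      theta_half ((of_int (a' * D) * z + of_int (e * b')) / (of_int (c' * D * e) * z + of_int d')) 1 =
      L * csqrt (of_int (c' * D * e) * z + of_int d') * theta_half z 1"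
    using theta_half_moebius by blast

  (* On the half-plane of convergence the principal root of c * z + d, which the determinant 1 law supplies,
     is a constant multiple of the required root of D * (c * z + d). For D = -1 and c nonzero the constant
     differs between the two half-planes. *)
  have S_sub: "?S \<subseteq> {z. Im z \<noteq> 0}" by auto
  have lin_nz: "of_real c * z + of_real d \<noteq> 0" if "z \<in> ?S" for z
    by (rule linear_nonzero) (use that S_sub cd in auto)
  have "\<exists>M. \<forall>z\<in>?S. csqrt (of_real c * z + of_real d) = M * sqrt_pm (of_real (of_int D) * (of_real c * z + of_real d))"
  proof (rule square_proportional_imp_proportional[where \<kappa> = "of_int D"])
    show "connected ?S"
      using De by (elim disjE) (simp_all add: convex_connected convex_halfspace_Im_gt convex_halfspace_Im_lt)
    show "continuous_on ?S (\<lambda>z. csqrt (of_real c * z + of_real d))"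
      by (rule continuous_on_subset[OF continuous_on_csqrt_linear S_sub])
    show "continuous_on ?S (\<lambda>z. sqrt_pm (of_real (of_int D) * (of_real c * z + of_real d)))"
      using continuous_on_subset[OF continuous_on_sqrt_pm_linear[of "of_int D * c" "of_int D * d"] S_sub]
      by (simp add: algebra_simps)
    fix z assume "z \<in> ?S"
    hence nz: "of_real (of_int D) * (of_real c * z + of_real d) \<noteq> 0" using lin_nz[of z] D by auto
    thus "sqrt_pm (of_real (of_int D) * (of_real c * z + of_real d)) \<noteq> 0"
      by (metis sqrt_pm_squared power_zero_numeral)
    have "complex_of_int D * of_int D = 1" using sq1(1) by (metis of_int_1 of_int_mult)
    thus "csqrt (of_real c * z + of_real d) ^ 2 = of_int D * sqrt_pm (of_real (of_int D) * (of_real c * z + of_real d)) ^ 2"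
      by (simp add: sqrt_pm_squared mult.assoc[symmetric])
  qed
  then obtain M where M: "\<And>z. z \<in> ?S \<Longrightarrow> csqrt (of_real c * z + of_real d) = M * sqrt_pm (of_real (det \<gamma>) * (of_real c * z + of_real d))"
    unfolding detD by blast

  have half: "theta_half ((of_real a * z + of_real b) / (of_real c * z + of_real d)) \<epsilon> =
      (L * M) * sqrt_pm (of_real (det \<gamma>) * (of_real c * z + of_real d)) *
      theta_half (of_int (D * e) * z) 1" if z: "z \<in> Hpm" for z
  proof -
    define w where "w = (of_real a * z + of_real b) / (of_real c * z + of_real d)"
    have Imz: "Im z \<noteq> 0" using z by (simp add: Hpm_def)
    show ?thesis
    proof (cases "z \<in> ?S")
      case True
      define t where "t = of_int (D * e) * z"
      have t: "Im t > 0" using True by (simp add: t_def)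
      have DD: "complex_of_int D * of_int D = 1" "complex_of_int e * of_int e = 1"
        using sq1 by (metis of_int_1 of_int_mult)+
      have "of_int (c' * D * e) * t + of_int d' = (complex_of_int D * of_int D) * (complex_of_int e * of_int e) * (of_int c' * z) + of_int d'"
        by (simp add: t_def mult_ac)
      hence den: "of_int (c' * D * e) * t + of_int d' = of_real c * z + of_real d"
        by (simp add: DD eqs)
      have "of_int (a' * D) * t + of_int (e * b') = (complex_of_int D * of_int D) * of_int e * (of_int a' * z) + of_int e * of_int b'"
        by (simp add: t_def mult_ac)
      hence num: "of_int (a' * D) * t + of_int (e * b') = of_real \<epsilon> * (of_real a * z + of_real b)"
        by (simp add: DD eqs e(1) algebra_simps)
      have "theta_half w \<epsilon> = theta_half ((of_int (a' * D) * t + of_int (e * b')) / (of_int (c' * D * e) * t + of_int d')) 1"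
        unfolding den num by (subst theta_half_scale) (simp add: w_def)
      also have "\<dots> = L * csqrt (of_real c * z + of_real d) * theta_half t 1"
        using L[OF t] unfolding den .
      finally show ?thesis unfolding M[OF True] w_def t_def by (simp only: mult_ac)
    next
      case False
      have neg: "of_int (D * e) * Im z < 0" using De False Imz by (elim disjE) simp_all
      have r: "theta_half (of_int (D * e) * z) 1 = 0"
        by (rule theta_half_divergent) (use neg in simp)
      have "Im (of_real \<epsilon> * w) = \<epsilon> * Im w" by simp
      also have "Im w = (a * d - b * c) * Im z / (cmod (of_real c * z + of_real d))^2"
        unfolding w_def by (rule Im_moebius)
      also have "\<epsilon> * \<dots> = (of_int (D * e) * Im z) / (cmod (of_real c * z + of_real d))^2"
        by (simp add: D_def eqs e(1))
      also have "\<dots> < 0"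
        using neg linear_nonzero[OF Imz cd] by (intro divide_neg_pos) auto
      finally have "theta_half (of_real \<epsilon> * w) 1 = 0" by (rule theta_half_divergent)
      hence "theta_half w \<epsilon> = 0" by (subst theta_half_scale)
      thus ?thesis unfolding w_def r by simp
    qed
  qed

  have sum_half: "(\<Sum>\<^sub>\<infinity>n::int. exp (\<i> * of_real (det \<gamma>) * of_real \<epsilon> * of_real pi * of_int n ^ 2 * z))
      = theta_half (of_int (D * e) * z) 1" for z
    unfolding theta_half_def detD e(1) by (simp add: mult_ac)
  have "theta_three_half ((of_real a * z + of_real b) / (of_real c * z + of_real d)) \<epsilon> = 0" for z
    unfolding theta_three_half_def by (rule odd_theta_series_zero)
  moreover have "(\<Sum>\<^sub>\<infinity>n::int. of_int n * exp (\<i> * of_real (det \<gamma>) * of_real \<epsilon> * of_real pi * of_int n ^ 2 * z)) = 0" for z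
    by (rule odd_theta_series_zero)
  ultimately show ?thesis
    using half by (intro exI[of _ "L * M"] ballI conjI) (simp_all only: sum_half mult_zero_right)
qed


end
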